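(* Krylov subspace methods are globally conservative if the initial guess has the same mass as the right-hand side: let $|\Omega_1|,\dots,|\Omega_m|>0$, $\alpha\in\mathbb R$, $\mathbf b\in\mathbb R^m$, and let $\mathbf A\in\mathbb R^{m\times m}$ satisfy $\sum_{i=1}^m|\Omega_i|(\mathbf A\mathbf y)_i=0$ for all $\mathbf y\in\mathbb R^m$. Let $\mathbf u^{(0)}\in\mathbb R^m$ with $\sum_{i=1}^m|\Omega_i|u^{(0)}_i=\sum_{i=1}^m|\Omega_i|b_i$, and set $\mathbf r^{(0)}=\mathbf b-(\mathbf I-\alpha\mathbf A)\mathbf u^{(0)}$. Then for every $k\ge1$ and every $$\mathbf u^{(k)}\in\mathbf u^{(0)}+\operatorname{span}\left\{\mathbf r^{(0)},(\mathbf I-\alpha\mathbf A)\mathbf r^{(0)},\dots,(\mathbf I-\alpha\mathbf A)^{k-1}\mathbf r^{(0)}\right\}$$ one has $$\sum_{i=1}^m|\Omega_i|u_i^{(k)}=\sum_{i=1}^m|\Omega_i|b_i.$$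
   Context: The linear system being solved is $(\mathbf I-\alpha\mathbf A)\mathbf u=\mathbf b$ on a mesh with cells $\Omega_i$ of volume $|\Omega_i|$. The mass of a vector $\mathbf y\in\mathbb R^m$ is $\sum_{i=1}^m|\Omega_i|y_i$. A Krylov subspace method (without preconditioner) is any method whose $k$th iterate lies in the affine space displayed in the claim. *)

theory Defs
  imports "HOL-Analysis.Analysis"
begin

definition mass :: "('m::finite \<Rightarrow> real) \<Rightarrow> real ^ 'm \<Rightarrow> real" where
  "mass vol y = (\<Sum>i\<in>UNIV. vol i * y $ i)"

(* The power operator of the class power is not used: on vector types the
   multiplication of that class is componentwise, not the matrix product. *)
primrec matrix_pow :: "real ^ 'm ^ 'm \<Rightarrow> nat \<Rightarrow> real ^ 'm ^ 'm" where
  "matrix_pow M 0 = mat 1"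
| "matrix_pow M (Suc j) = M ** matrix_pow M j"

definition krylov_space :: "real ^ 'm ^ 'm \<Rightarrow> real ^ 'm \<Rightarrow> nat \<Rightarrow> (real ^ 'm) set" where
  "krylov_space M r k = span {matrix_pow M j *v r | j. j < k}"

end

theory Submission
  imports Defs
begin

text \<open>
  Mass is a linear functional that vanishes on the range of \<open>A\<close>, so the system matrix
  \<open>I - \<alpha>A\<close> preserves mass (\<open>mass_system_matrix\<close>). Hence the initial residual has mass
  \<open>mass b - mass u0 = 0\<close>, and so does every vector obtained from it by powers of the
  system matrix. The massless vectors form a subspace, namely the kernel of the mass
  functional, which therefore contains the whole Krylov space (\<open>mass_krylov_space\<close>):
  corrections taken from it do not change the mass of the initial guess.
\<close>

lemma linear_mass: "linear (mass vol)"
  by (rule linearI)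
    (simp_all add: mass_def algebra_simps sum.distrib sum_distrib_left)

lemma mass_system_matrix:
  fixes A :: "real ^ 'm ^ 'm"
  assumes "\<And>y. mass vol (A *v y) = 0"
  shows "mass vol ((mat 1 - \<alpha> *\<^sub>R A) *v y) = mass vol y"
proof -
  have "(mat 1 - \<alpha> *\<^sub>R A) *v y = y - \<alpha> *\<^sub>R (A *v y)"
    by (simp add: matrix_vector_mult_diff_rdistrib scaleR_matrix_vector_assoc)
  then show ?thesis
    by (simp add: assms linear_diff[OF linear_mass] linear_scale[OF linear_mass])
qed

lemma mass_matrix_pow:
  assumes "\<And>y. mass vol (M *v y) = mass vol y"
  shows "mass vol (matrix_pow M j *v r) = mass vol r"
  by (induction j) (simp_all add: assms flip: matrix_vector_mul_assoc)

lemma mass_krylov_space: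
  assumes M: "\<And>y. mass vol (M *v y) = mass vol y"
    and r: "mass vol r = 0"
    and v: "v \<in> krylov_space M r k"
  shows "mass vol v = 0"
proof (rule linear_eq_0_on_span[OF linear_mass])
  show "v \<in> span {matrix_pow M j *v r | j. j < k}"
    using v by (simp add: krylov_space_def)
  show "mass vol x = 0" if "x \<in> {matrix_pow M j *v r | j. j < k}" for x
    using that mass_matrix_pow[OF M] r by auto
qed

theorem mainTheorem6:
  fixes vol :: "'m::finite \<Rightarrow> real"
    and \<alpha> :: real
    and A :: "real ^ 'm ^ 'm"
    and b u0 r0 :: "real ^ 'm"
  assumes vol_pos: "\<And>i. vol i > 0"
    and A_conservative: "\<And>y :: real ^ 'm. mass vol (A *v y) = 0"
    and u0_mass: "mass vol u0 = mass vol b"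
    and r0_def: "r0 = b - (mat 1 - \<alpha> *\<^sub>R A) *v u0"
  shows "\<forall>k\<ge>1. \<forall>u \<in> (\<lambda>v. u0 + v) ` krylov_space (mat 1 - \<alpha> *\<^sub>R A) r0 k.
           mass vol u = mass vol b"
proof -
  note M = mass_system_matrix[OF A_conservative]
  have "mass vol r0 = 0"
    by (simp add: r0_def linear_diff[OF linear_mass] M u0_mass)
  then show ?thesis
    by (auto simp: linear_add[OF linear_mass] u0_mass mass_krylov_space[OF M])
qed

end
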